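(* Let $X$ be a two-sided shift space on a finite alphabet with language $\mathcal L$, and $\varphi\colon X\to\mathbb R$ a continuous potential. For each $x\in X$, let $m^{\mathrm u}_x$ be the unstable leaf measure on $W^{\mathrm u}_{\mathrm{loc}}(x)$ and $m^{\mathrm s}_x$ the stable leaf measure on $W^{\mathrm s}_{\mathrm{loc}}(x)$. Then for every $x\in X$ $$\overline Q^+_x/\overline Q\le m^{\mathrm u}_x(W^{\mathrm u}_{\mathrm{loc}}(x))\le\underline Q^+_x,\qquad \overline Q^-_x/\overline Q\le m^{\mathrm s}_x(W^{\mathrm s}_{\mathrm{loc}}(x))\le\underline Q^-_x.$$
   Context: Let $A$ be a finite set and $\sigma\colon A^{\mathbb Z}\to A^{\mathbb Z}$ the shift $(\sigma x)_n=x_{n+1}$; $A^{\mathbb Z}$ has the metric $d(x,y)=2^{-\min\{|n|:x_n\ne y_n\}}$. A two-sided shift space is a (nonempty) closed $\sigma$-invariant set $X\subset A^{\mathbb Z}$. For $w\in A^n$ (length $|w|=n$) let $[w]^+=\{x\in X:x_{[0,n)}=w\}$ and $[w]^-=\{x\in X:x_{(-n,0]}=w\}$; $\mathcal L_n=\{w\in A^n:[w]^+\ne\emptyset\}$, $\mathcal L=\bigcup_{n\ge0}\mathcal L_n$, $\mathcal L_{\ge N}=\{w\in\mathcal L:|w|\ge N\}$. With $S_n\varphi(x)=\sum_{k=0}^{n-1}\varphi(\sigma^kx)$, put $\Phi(w)=\sup_{x\in[w]^+}S_{|w|}\varphi(x)$, $\Lambda_n=\sum_{w\in\mathcal L_n}e^{\Phi(w)}$,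 and $P=\lim_{n\to\infty}\frac1n\log\Lambda_n$ (topological pressure; the limit exists). Put $\overline Q=\varlimsup_{n\to\infty}\Lambda_ne^{-nP}\in[1,\infty]$. Leaves: $W^{\mathrm u}_{\mathrm{loc}}(x)=\{y\in X:y_k=x_k\ \forall k\le0\}$, $W^{\mathrm s}_{\mathrm{loc}}(x)=\{y\in X:y_k=x_k\ \forall k\ge0\}$. Weights: $\Phi^+_x(w)=\sup\{S_{|w|}\varphi(y):y\in W^{\mathrm u}_{\mathrm{loc}}(x)\cap[w]^+\}$ and $\Phi^-_x(w)=\sup\{\sum_{k=0}^{|w|-1}\varphi(\sigma^{-k}y):y\in W^{\mathrm s}_{\mathrm{loc}}(x)\cap[w]^-\}$, with $\sup\emptyset=-\infty$, $e^{-\infty}=0$. Covers: $\mathbb E^{\pm}(Z,N)=\{\mathcal E\subset\mathcal L_{\ge N}:Z\subset\bigcup_{w\in\mathcal E}[w]^{\pm}\}$. Leaf measures (these are Borel measures): $$m^{\mathrm u}_x(Z)=\lim_{N\to\infty}\inf\Big\{\sum_{w\in\mathcal E}e^{\Phi^+_x(w)-|w|P}:\mathcal E\in\mathbb E^+(Z,N)\Big\}\quad(Z\subset W^{\mathrm u}_{\mathrm{loc}}(x)),$$ $$m^{\mathrm s}_x(Z)=\lim_{N\to\infty}\inf\Big\{\sum_{w\in\mathcal E}e^{\Phi^-_x(w)-|w|P}:\mathcal E\in\mathbb E^-(Z,N)\Big\}\quad(Z\subset W^{\mathrm s}_{\mathrm{loc}}(x)).$$ Leaf partition sums: $\Lambda^{\pm}_n(x)=\sum_{w\in\mathcal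 L_n}e^{\Phi^{\pm}_x(w)}$, $\overline Q^{\pm}_x=\varlimsup_{n\to\infty}\Lambda^{\pm}_n(x)e^{-nP}$, $\underline Q^{\pm}_x=\varliminf_{n\to\infty}\Lambda^{\pm}_n(x)e^{-nP}$. A quotient with denominator $\overline Q=\infty$ is interpreted as $0$. *)

theory Defs
  imports "HOL-Analysis.Analysis"
begin

definition full_shift :: "'a set \<Rightarrow> (int \<Rightarrow> 'a) set" where
  "full_shift A = {x. \<forall>n. x n \<in> A}"

definition shift :: "(int \<Rightarrow> 'a) \<Rightarrow> int \<Rightarrow> 'a" where
  "shift x = (\<lambda>n. x (n + 1))"

definition shift_dist :: "(int \<Rightarrow> 'a) \<Rightarrow> (int \<Rightarrow> 'a) \<Rightarrow> real" where
  "shift_dist x y =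
     (if x = y then 0 else (1 / 2) ^ (LEAST k. \<exists>n. k = nat \<bar>n\<bar> \<and> x n \<noteq> y n))"

definition full_shift_topology :: "'a set \<Rightarrow> (int \<Rightarrow> 'a) topology" where
  "full_shift_topology A = Metric_space.mtopology (full_shift A) shift_dist"

text \<open>Two-sided shift spaces are invariant in the sense that the image under the shift is
  the whole space, so that backward iterates stay inside.\<close>

definition shift_space :: "'a set \<Rightarrow> (int \<Rightarrow> 'a) set \<Rightarrow> bool" where
  "shift_space A X \<longleftrightarrow>
     finite A \<and> X \<noteq> {} \<and> closedin (full_shift_topology A) X \<and> shift ` X = X"

definition potential :: "'a set \<Rightarrow> (int \<Rightarrow> 'a) set \<Rightarrow> ((int \<Rightarrow> 'a) \<Rightarrow> real) \<Rightarrow> bool" where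
  "potential A X \<phi> \<longleftrightarrow>
     continuous_map (subtopology (full_shift_topology A) X) euclideanreal \<phi>"

definition cyl_plus :: "(int \<Rightarrow> 'a) set \<Rightarrow> 'a list \<Rightarrow> (int \<Rightarrow> 'a) set" where
  "cyl_plus X w = {x \<in> X. \<forall>i < length w. x (int i) = w ! i}"

text \<open>The letters of \<open>w\<close> occupy the positions \<open>-n+1, \<dots>, 0\<close>, where \<open>n\<close> is the length of \<open>w\<close>.\<close>

definition cyl_minus :: "(int \<Rightarrow> 'a) set \<Rightarrow> 'a list \<Rightarrow> (int \<Rightarrow> 'a) set" where
  "cyl_minus X w = {x \<in> X. \<forall>i < length w. x (int i - int (length w) + 1) = w ! i}"

text \<open>Words are not explicitly restricted to the alphabet: a nonempty cylinder forces this.\<close>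

definition words :: "(int \<Rightarrow> 'a) set \<Rightarrow> nat \<Rightarrow> 'a list set" where
  "words X n = {w. length w = n \<and> cyl_plus X w \<noteq> {}}"

definition words_ge :: "(int \<Rightarrow> 'a) set \<Rightarrow> nat \<Rightarrow> 'a list set" where
  "words_ge X N = {w \<in> (\<Union>n. words X n). length w \<ge> N}"

definition birkhoff :: "((int \<Rightarrow> 'a) \<Rightarrow> real) \<Rightarrow> nat \<Rightarrow> (int \<Rightarrow> 'a) \<Rightarrow> real" where
  "birkhoff \<phi> n x = (\<Sum>k<n. \<phi> ((shift ^^ k) x))"

definition back_birkhoff :: "((int \<Rightarrow> 'a) \<Rightarrow> real) \<Rightarrow> nat \<Rightarrow> (int \<Rightarrow> 'a) \<Rightarrow> real" where
  "back_birkhoff \<phi> n x = (\<Sum>k<n. \<phi> ((inv shift ^^ k) x))"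

text \<open>The weight of a word is a real supremum; it is used only for words of the language, for
  which the set is nonempty, and bounded because the potential is continuous on a compact space.\<close>

definition weight :: "(int \<Rightarrow> 'a) set \<Rightarrow> ((int \<Rightarrow> 'a) \<Rightarrow> real) \<Rightarrow> 'a list \<Rightarrow> real" where
  "weight X \<phi> w = (SUP x \<in> cyl_plus X w. birkhoff \<phi> (length w) x)"

definition partition_sum :: "(int \<Rightarrow> 'a) set \<Rightarrow> ((int \<Rightarrow> 'a) \<Rightarrow> real) \<Rightarrow> nat \<Rightarrow> real" where
  "partition_sum X \<phi> n = (\<Sum>w \<in> words X n. exp (weight X \<phi> w))"

definition pressure :: "(int \<Rightarrow> 'a) set \<Rightarrow> ((int \<Rightarrow> 'a) \<Rightarrow> real) \<Rightarrow> real" where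
  "pressure X \<phi> = lim (\<lambda>n. 1 / real n * ln (partition_sum X \<phi> n))"

definition Q_sup :: "(int \<Rightarrow> 'a) set \<Rightarrow> ((int \<Rightarrow> 'a) \<Rightarrow> real) \<Rightarrow> ennreal" where
  "Q_sup X \<phi> =
     limsup (\<lambda>n. ennreal (partition_sum X \<phi> n * exp (- (real n * pressure X \<phi>))))"

definition W_u :: "(int \<Rightarrow> 'a) set \<Rightarrow> (int \<Rightarrow> 'a) \<Rightarrow> (int \<Rightarrow> 'a) set" where
  "W_u X x = {y \<in> X. \<forall>k \<le> 0. y k = x k}"

definition W_s :: "(int \<Rightarrow> 'a) set \<Rightarrow> (int \<Rightarrow> 'a) \<Rightarrow> (int \<Rightarrow> 'a) set" where
  "W_s X x = {y \<in> X. \<forall>k \<ge> 0. y k = x k}"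

definition exp_ereal :: "ereal \<Rightarrow> ennreal" where
  "exp_ereal a = (case a of ereal r \<Rightarrow> ennreal (exp r) | PInfty \<Rightarrow> \<infinity> | MInfty \<Rightarrow> 0)"

text \<open>The supremum over an empty set is \<open>-\<infinity>\<close> in the extended reals.\<close>

definition weight_plus ::
    "(int \<Rightarrow> 'a) set \<Rightarrow> ((int \<Rightarrow> 'a) \<Rightarrow> real) \<Rightarrow> (int \<Rightarrow> 'a) \<Rightarrow> 'a list \<Rightarrow> ereal" where
  "weight_plus X \<phi> x w = (SUP y \<in> W_u X x \<inter> cyl_plus X w. ereal (birkhoff \<phi> (length w) y))"

definition weight_minus ::
    "(int \<Rightarrow> 'a) set \<Rightarrow> ((int \<Rightarrow> 'a) \<Rightarrow> real) \<Rightarrow> (int \<Rightarrow> 'a) \<Rightarrow> 'a list \<Rightarrow> ereal" where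
  "weight_minus X \<phi> x w = (SUP y \<in> W_s X x \<inter> cyl_minus X w. ereal (back_birkhoff \<phi> (length w) y))"

definition covers_plus ::
    "(int \<Rightarrow> 'a) set \<Rightarrow> (int \<Rightarrow> 'a) set \<Rightarrow> nat \<Rightarrow> 'a list set set" where
  "covers_plus X Z N = {E. E \<subseteq> words_ge X N \<and> Z \<subseteq> (\<Union>w\<in>E. cyl_plus X w)}"

definition covers_minus ::
    "(int \<Rightarrow> 'a) set \<Rightarrow> (int \<Rightarrow> 'a) set \<Rightarrow> nat \<Rightarrow> 'a list set set" where
  "covers_minus X Z N = {E. E \<subseteq> words_ge X N \<and> Z \<subseteq> (\<Union>w\<in>E. cyl_minus X w)}"

text \<open>Covers may be infinite, hence the unordered infinite sums, which always exist in
  \<^typ>\<open>ennreal\<close>. The infima increase with \<open>N\<close>, so the limits exist.\<close>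

definition m_u :: "(int \<Rightarrow> 'a) set \<Rightarrow> ((int \<Rightarrow> 'a) \<Rightarrow> real) \<Rightarrow> (int \<Rightarrow> 'a) \<Rightarrow>
    (int \<Rightarrow> 'a) set \<Rightarrow> ennreal" where
  "m_u X \<phi> x Z = lim (\<lambda>N. INF E \<in> covers_plus X Z N.
     \<Sum>\<^sub>\<infinity>w\<in>E. exp_ereal (weight_plus X \<phi> x w - ereal (real (length w) * pressure X \<phi>)))"

definition m_s :: "(int \<Rightarrow> 'a) set \<Rightarrow> ((int \<Rightarrow> 'a) \<Rightarrow> real) \<Rightarrow> (int \<Rightarrow> 'a) \<Rightarrow>
    (int \<Rightarrow> 'a) set \<Rightarrow> ennreal" where
  "m_s X \<phi> x Z = lim (\<lambda>N. INF E \<in> covers_minus X Z N.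
     \<Sum>\<^sub>\<infinity>w\<in>E. exp_ereal (weight_minus X \<phi> x w - ereal (real (length w) * pressure X \<phi>)))"

definition partition_sum_plus ::
    "(int \<Rightarrow> 'a) set \<Rightarrow> ((int \<Rightarrow> 'a) \<Rightarrow> real) \<Rightarrow> (int \<Rightarrow> 'a) \<Rightarrow> nat \<Rightarrow> ennreal" where
  "partition_sum_plus X \<phi> x n = (\<Sum>w \<in> words X n. exp_ereal (weight_plus X \<phi> x w))"

definition partition_sum_minus ::
    "(int \<Rightarrow> 'a) set \<Rightarrow> ((int \<Rightarrow> 'a) \<Rightarrow> real) \<Rightarrow> (int \<Rightarrow> 'a) \<Rightarrow> nat \<Rightarrow> ennreal" where
  "partition_sum_minus X \<phi> x n = (\<Sum>w \<in> words X n. exp_ereal (weight_minus X \<phi> x w))"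

definition Q_plus_sup ::
    "(int \<Rightarrow> 'a) set \<Rightarrow> ((int \<Rightarrow> 'a) \<Rightarrow> real) \<Rightarrow> (int \<Rightarrow> 'a) \<Rightarrow> ennreal" where
  "Q_plus_sup X \<phi> x =
     limsup (\<lambda>n. partition_sum_plus X \<phi> x n * ennreal (exp (- (real n * pressure X \<phi>))))"

definition Q_plus_inf ::
    "(int \<Rightarrow> 'a) set \<Rightarrow> ((int \<Rightarrow> 'a) \<Rightarrow> real) \<Rightarrow> (int \<Rightarrow> 'a) \<Rightarrow> ennreal" where
  "Q_plus_inf X \<phi> x =
     liminf (\<lambda>n. partition_sum_plus X \<phi> x n * ennreal (exp (- (real n * pressure X \<phi>))))"

definition Q_minus_sup ::
    "(int \<Rightarrow> 'a) set \<Rightarrow> ((int \<Rightarrow> 'a) \<Rightarrow> real) \<Rightarrow> (int \<Rightarrow> 'a) \<Rightarrow> ennreal" where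
  "Q_minus_sup X \<phi> x =
     limsup (\<lambda>n. partition_sum_minus X \<phi> x n * ennreal (exp (- (real n * pressure X \<phi>))))"

definition Q_minus_inf ::
    "(int \<Rightarrow> 'a) set \<Rightarrow> ((int \<Rightarrow> 'a) \<Rightarrow> real) \<Rightarrow> (int \<Rightarrow> 'a) \<Rightarrow> ennreal" where
  "Q_minus_inf X \<phi> x =
     liminf (\<lambda>n. partition_sum_minus X \<phi> x n * ennreal (exp (- (real n * pressure X \<phi>))))"

text \<open>The metric does turn the full shift into a metric space, so that
  \<^const>\<open>full_shift_topology\<close> is the metric topology.\<close>

lemma shift_dist_less_iff:
  "shift_dist x y < (1 / 2) ^ m \<longleftrightarrow> (\<forall>n. nat \<bar>n\<bar> \<le> m \<longrightarrow> x n = y n)"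
proof (cases "x = y")
  case True
  then show ?thesis by (simp add: shift_dist_def)
next
  case False
  define L where "L = (LEAST k. \<exists>n. k = nat \<bar>n\<bar> \<and> x n \<noteq> y n)"
  have "\<exists>k n. k = nat \<bar>n\<bar> \<and> x n \<noteq> y n"
    using False by auto
  then have "\<exists>n. L = nat \<bar>n\<bar> \<and> x n \<noteq> y n"
    unfolding L_def by (rule LeastI_ex)
  then obtain n where n: "L = nat \<bar>n\<bar>" "x n \<noteq> y n"
    by auto
  have le: "L \<le> nat \<bar>j\<bar>" if "x j \<noteq> y j" for j
    unfolding L_def using that by (intro Least_le) auto
  have "shift_dist x y < (1 / 2) ^ m \<longleftrightarrow> m < L"
    using False by (simp add: shift_dist_def L_def power_strict_decreasing_iff)
  also have "\<dots> \<longleftrightarrow> (\<forall>j. nat \<bar>j\<bar> \<le> m \<longrightarrow> x j = y j)"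
  proof
    assume "m < L"
    then show "\<forall>j. nat \<bar>j\<bar> \<le> m \<longrightarrow> x j = y j"
      using le by (meson le_less_trans linorder_not_less)
  next
    assume "\<forall>j. nat \<bar>j\<bar> \<le> m \<longrightarrow> x j = y j"
    then show "m < L"
      using n by (meson not_le)
  qed
  finally show ?thesis .
qed

lemma shift_dist_commute: "shift_dist x y = shift_dist y x"
proof -
  have "(x n \<noteq> y n) = (y n \<noteq> x n)" for n by auto
  moreover have "x = y \<longleftrightarrow> y = x" by auto
  ultimately show ?thesis
    unfolding shift_dist_def by presburger
qed

lemma shift_dist_nonneg: "0 \<le> shift_dist x y"
  unfolding shift_dist_def by auto

lemma shift_dist_eq_0: "shift_dist x y = 0 \<longleftrightarrow> x = y"
  unfolding shift_dist_def by auto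

lemma shift_dist_ultra: "shift_dist x z \<le> max (shift_dist x y) (shift_dist y z)"
proof (rule ccontr)
  assume "\<not> ?thesis"
  then have *: "shift_dist x y < shift_dist x z" "shift_dist y z < shift_dist x z"
    by auto
  then have "x \<noteq> z"
    using shift_dist_nonneg[of x y] shift_dist_eq_0[of x z] by auto
  then obtain m where m: "shift_dist x z = (1 / 2) ^ m"
    unfolding shift_dist_def by auto
  then have "\<forall>n. nat \<bar>n\<bar> \<le> m \<longrightarrow> x n = z n"
    using * unfolding m shift_dist_less_iff by auto
  then have "shift_dist x z < (1 / 2) ^ m"
    by (simp add: shift_dist_less_iff)
  then show False
    using m by simp
qed

lemma Metric_space_full_shift: "Metric_space (full_shift A) shift_dist"
proof
  fix x y z :: "int \<Rightarrow> 'a"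
  show "shift_dist x z \<le> shift_dist x y + shift_dist y z"
    using shift_dist_ultra[of x z y] shift_dist_nonneg[of x y] shift_dist_nonneg[of y z] by simp
qed (simp_all add: shift_dist_nonneg shift_dist_eq_0 shift_dist_commute)

lemma inv_shift_funpow: "(inv shift ^^ k) x = (\<lambda>n. x (n - int k))"
proof -
  have "inv shift = (\<lambda>x n. x (n - 1) :: 'a)"
    by (rule inv_equality) (auto simp: shift_def)
  then show ?thesis
    by (induction k) (auto simp: algebra_simps)
qed

end

theory Submission
  imports Defs
begin

text \<open>The upper bounds hold because \<open>\<L>\<^sub>n\<close> is itself a cover for every \<open>n\<close>. For the lower bounds,
  compactness of the leaf reduces any cover to a finite one \<open>\<E>\<close>. Once \<open>n\<close> exceeds all lengths in
  \<open>\<E>\<close>, every word of length \<open>n\<close> that meets the leaf is a word \<open>w \<in> \<E>\<close> extended by some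
  \<open>v \<in> \<L>\<close>, and the weights are submultiplicative, so
  \<open>\<Lambda>\<^sup>+\<^sub>n(x) e\<^sup>-\<^sup>n\<^sup>P \<le> \<Sum>\<^bsub>w\<in>\<E>\<^esub> e\<^bsup>\<Phi>\<^sup>+(w)-|w|P\<^esup> \<Lambda>\<^bsub>n-|w|\<^esub> e\<^bsup>-(n-|w|)P\<^esup>\<close>; let \<open>n\<close> tend to infinity.
  On stable leaves, words are extended to the left instead.\<close>

section \<open>Weighted covers by words\<close>

text \<open>For any \<open>c\<close> above \<open>limsup g\<close>, every \<open>g (n - l w)\<close>
  is eventually below \<open>c\<close>, so \<open>limsup f \<le> sum a E * c\<close>; then
  \<open>c\<close> is lowered to \<open>limsup g\<close>. The quotient form covers
  \<open>limsup g = \<infinity>\<close>, where the left side is \<open>0\<close>.\<close>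

lemma limsup_quotient_le_sum:
  fixes f g :: "nat \<Rightarrow> ennreal" and a :: "'b \<Rightarrow> ennreal" and l :: "'b \<Rightarrow> nat"
  assumes fin: "finite E"
    and le: "\<And>n. (\<forall>w\<in>E. l w \<le> n) \<Longrightarrow> f n \<le> (\<Sum>w\<in>E. a w * g (n - l w))"
  shows "limsup f / limsup g \<le> sum a E"
proof -
  define S where "S = sum a E"
  define Q where "Q = limsup g"
  have bound: "limsup f \<le> S * c" if "Q < c" for c
  proof -
    have "eventually (\<lambda>k. g k < c) sequentially"
      using that unfolding Q_def by (rule Limsup_lessD)
    then obtain K where K: "\<And>k. k \<ge> K \<Longrightarrow> g k < c"
      unfolding eventually_sequentially by blast
    \<comment> \<open>\<open>sum l E\<close> dominates every \<open>l w\<close>, so one threshold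
      serves all of \<open>E\<close>, and the subtraction \<open>n - l w\<close> is never
      truncated.\<close>
    have "f n \<le> S * c" if n: "n \<ge> K + sum l E" for n
    proof -
      have l: "l w \<le> n" "K \<le> n - l w" if "w \<in> E" for w
        using member_le_sum[OF that, of l] fin n by auto
      have "f n \<le> (\<Sum>w\<in>E. a w * g (n - l w))"
        using l(1) by (intro le) blast
      also have "\<dots> \<le> (\<Sum>w\<in>E. a w * c)"
        using less_imp_le[OF K[OF l(2)]] by (intro sum_mono mult_left_mono) simp_all
      finally show ?thesis
        by (simp add: S_def sum_distrib_right)
    qed
    then show ?thesis
      by (intro Limsup_bounded) (auto simp: eventually_sequentially)
  qed
  consider "S = \<infinity>" | "Q = \<infinity>" | "S = 0" "Q < \<infinity>" | "S \<noteq> 0" "S < \<infinity>" "Q < \<infinity>"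
    by (metis infinity_ennreal_def top.not_eq_extremum)
  then have "limsup f / Q \<le> S"
  proof cases
    case 3
    then show ?thesis
      \<comment> \<open>\<open>c = \<infinity>\<close> suffices, since
        \<open>0 * \<infinity> = 0\<close> in \<open>ennreal\<close>.\<close>
      using bound[of \<infinity>] by simp
  next
    case 4
    \<comment> \<open>Dividing by \<open>S\<close>, positive and finite here, leaves a bare
      \<open>c\<close> on the right, which density of the order replaces by
      \<open>Q\<close>.\<close>
    have "limsup f / S \<le> Q"
    proof (rule dense_ge)
      fix c assume "Q < c"
      then show "limsup f / S \<le> c"
        using bound[of c] 4 by (intro divide_le_posI_ennreal) (auto simp: mult.commute zero_less_iff_neq_zero)
    qed
    then have "limsup f / S * S \<le> Q * S"
      by (rule mult_right_mono) simp
    then have *: "limsup f \<le> Q * S"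
      using 4 by (simp add: ennreal_divide_times ennreal_divide_self)
    show ?thesis
    proof (cases "Q = 0")
      case True
      then show ?thesis using * by simp
    next
      case False
      then show ?thesis
        using * 4 by (intro divide_le_posI_ennreal) (auto simp: mult.commute zero_less_iff_neq_zero)
    qed
  qed (auto simp: divide_ennreal_def)
  then show ?thesis
    by (simp add: S_def Q_def)
qed

text \<open>The function \<open>j\<close> extends a word by another one, to the right on unstable leaves and to the
  left on stable ones.\<close>

lemma leaf_measure_bounds:
  fixes L :: "nat \<Rightarrow> 'a list set" and C :: "'a list \<Rightarrow> 'b set" and W :: "'b set"
    and a b :: "'a list \<Rightarrow> ennreal" and j :: "'a list \<Rightarrow> 'a list \<Rightarrow> 'a list"
  defines "h \<equiv> \<lambda>N. INF E \<in> {E. E \<subseteq> {w \<in> \<Union>n. L n. length w \<ge> N} \<and> W \<subseteq> (\<Union>w\<in>E. C w)}.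
      \<Sum>\<^sub>\<infinity>w\<in>E. a w"
  assumes fin: "\<And>n. finite (L n)"
    and len: "\<And>n w. w \<in> L n \<Longrightarrow> length w = n"
    and cover: "\<And>n. W \<subseteq> (\<Union>w\<in>L n. C w)"
    and compact: "\<And>E. W \<subseteq> (\<Union>w\<in>E. C w) \<Longrightarrow> \<exists>F\<subseteq>E. finite F \<and> W \<subseteq> (\<Union>w\<in>F. C w)"
    and null: "\<And>w. W \<inter> C w = {} \<Longrightarrow> a w = 0"
    and split: "\<And>y u w. y \<in> W \<Longrightarrow> y \<in> C u \<Longrightarrow> y \<in> C w \<Longrightarrow> u \<in> L (length u) \<Longrightarrow>
        length w \<le> length u \<Longrightarrow> \<exists>v \<in> L (length u - length w). u = j w v"
    and submult: "\<And>w v. a (j w v) \<le> a w * b v"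
  shows "limsup (\<lambda>n. sum a (L n)) / limsup (\<lambda>n. sum b (L n)) \<le> lim h"
    and "lim h \<le> liminf (\<lambda>n. sum a (L n))"
proof -
  have "incseq h"
    unfolding h_def incseq_def by (intro allI impI INF_superset_mono) auto
  then have lim: "lim h = (SUP N. h N)"
    by (intro limI LIMSEQ_SUP)
  show "lim h \<le> liminf (\<lambda>n. sum a (L n))"
    unfolding lim liminf_SUP_INF
  \<comment> \<open>\<open>liminf\<close> is a supremum of tail infima, so both sides are compared
    at the same index \<open>N\<close>: \<open>L n\<close> is admissible there for all
    \<open>n \<ge> N\<close>.\<close>
  proof (intro SUP_mono bexI INF_greatest)
    fix N n :: nat assume "n \<in> {N..}"
    then have "h N \<le> (\<Sum>\<^sub>\<infinity>w\<in>L n. a w)"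
      unfolding h_def using len cover[of n] by (intro INF_lower) auto
    then show "h N \<le> sum a (L n)"
      using fin by simp
  qed auto
  \<comment> \<open>As \<open>h\<close> increases, it is enough to bound \<open>h 0\<close>, whose
    covers use words of any length.\<close>
  have "limsup (\<lambda>n. sum a (L n)) / limsup (\<lambda>n. sum b (L n)) \<le> h 0"
    unfolding h_def
  proof (intro INF_greatest, clarsimp)
    fix E assume "W \<subseteq> (\<Union>w\<in>E. C w)"
    then obtain F where F: "F \<subseteq> E" "finite F" "W \<subseteq> (\<Union>w\<in>F. C w)"
      using compact by blast
    have "limsup (\<lambda>n. sum a (L n)) / limsup (\<lambda>n. sum b (L n)) \<le> sum a F"
    proof (rule limsup_quotient_le_sum[OF F(2), where l = length])
      fix n assume n: "\<forall>w\<in>F. length w \<le> n"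
      \<comment> \<open>A pair is a covering word with an extension that brings it to length
        \<open>n\<close>.\<close>
      define T where "T = (SIGMA w:F. L (n - length w))"
      have finT: "finite T"
        unfolding T_def using F fin by auto
      have sub: "{u \<in> L n. a u \<noteq> 0} \<subseteq> (\<lambda>(w, v). j w v) ` T"
      proof safe
        fix u assume u: "u \<in> L n" "a u \<noteq> 0"
        then obtain y where y: "y \<in> W" "y \<in> C u"
          using null by blast
        then obtain w where w: "w \<in> F" "y \<in> C w"
          using F by blast
        then obtain v where "v \<in> L (n - length w)" "u = j w v"
          using split[of y u w] y u n len[OF u(1)] by auto
        then show "u \<in> (\<lambda>(w, v). j w v) ` T"
          using w unfolding T_def by force
      qed
      have "sum a (L n) = sum a {u \<in> L n. a u \<noteq> 0}"
        using fin by (intro sum.mono_neutral_right) auto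
      also have "\<dots> \<le> sum a ((\<lambda>(w, v). j w v) ` T)"
        using sub finT by (intro sum_mono2) auto
      \<comment> \<open>\<open>j\<close> need not be injective on \<open>T\<close>; counting a word
        once per pair only enlarges the sum.\<close>
      also have "\<dots> \<le> sum (a \<circ> (\<lambda>(w, v). j w v)) T"
        using finT by (intro sum_image_le) auto
      also have "\<dots> \<le> (\<Sum>(w, v)\<in>T. a w * b v)"
        using submult by (intro sum_mono) auto
      also have "\<dots> = (\<Sum>w\<in>F. a w * sum b (L (n - length w)))"
        unfolding T_def using F fin by (simp add: sum.Sigma[symmetric] sum_distrib_left)
      finally show "sum a (L n) \<le> (\<Sum>w\<in>F. a w * sum b (L (n - length w)))" .
    qed
    also have "sum a F = (\<Sum>\<^sub>\<infinity>w\<in>F. a w)"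
      using F by simp
    also have "\<dots> \<le> (\<Sum>\<^sub>\<infinity>w\<in>E. a w)"
      using F by (intro infsum_mono_neutral) (auto intro: nonneg_summable_on_complete)
    finally show "limsup (\<lambda>n. sum a (L n)) / limsup (\<lambda>n. sum b (L n)) \<le> (\<Sum>\<^sub>\<infinity>w\<in>E. a w)" .
  qed
  also have "h 0 \<le> lim h"
    unfolding lim by (rule SUP_upper) simp
  finally show "limsup (\<lambda>n. sum a (L n)) / limsup (\<lambda>n. sum b (L n)) \<le> lim h" .
qed

section \<open>Compactness\<close>

lemma topspace_full_shift: "topspace (full_shift_topology A) = full_shift A"
  unfolding full_shift_topology_def
  by (simp add: Metric_space.topspace_mtopology[OF Metric_space_full_shift])

text \<open>The ball of radius \<open>(1/2) ^ nat \<bar>k\<bar>\<close> around \<open>y\<close>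
  fixes coordinate \<open>k\<close>. As \<open>B\<close> is arbitrary, complements show that these
  sets are closed too.\<close>

lemma openin_full_shift_coord:
  "openin (full_shift_topology A) {y \<in> full_shift A. y k \<in> B}"
  unfolding full_shift_topology_def Metric_space.openin_mtopology[OF Metric_space_full_shift]
proof (intro conjI allI impI)
  fix y assume y: "y \<in> {y \<in> full_shift A. y k \<in> B}"
  show "\<exists>r>0. Metric_space.mball (full_shift A) shift_dist y r \<subseteq> {y \<in> full_shift A. y k \<in> B}"
  proof (intro exI[of _ "(1/2) ^ nat \<bar>k\<bar>"] conjI subsetI)
    fix z assume "z \<in> Metric_space.mball (full_shift A) shift_dist y ((1/2) ^ nat \<bar>k\<bar>)"
    then have "z \<in> full_shift A" "shift_dist y z < (1/2) ^ nat \<bar>k\<bar>"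
      by (auto simp: Metric_space.in_mball[OF Metric_space_full_shift])
    then show "z \<in> {y \<in> full_shift A. y k \<in> B}"
      using y by (auto simp: shift_dist_less_iff)
  qed simp
qed auto

lemma closedin_full_shift_coord:
  "closedin (full_shift_topology A) {y \<in> full_shift A. y k \<in> B}"
proof -
  have "full_shift A - {y \<in> full_shift A. y k \<in> B} = {y \<in> full_shift A. y k \<in> - B}"
    by auto
  then show ?thesis
    using openin_full_shift_coord[of A k "- B"] by (auto simp: closedin_def topspace_full_shift)
qed

text \<open>\<open>I\<close> may be infinite, because leaves fix a half-line of coordinates.\<close>

lemma closedin_full_shift_agree:
  "closedin (full_shift_topology A) {y \<in> full_shift A. \<forall>k\<in>I. y k = x k}"
proof (cases "I = {}")
  \<comment> \<open>An empty intersection would give \<open>UNIV\<close> instead of the full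
    shift.\<close>
  case True
  then show ?thesis
    using closedin_topspace[of "full_shift_topology A"] by (simp add: topspace_full_shift)
next
  case False
  then have "{y \<in> full_shift A. \<forall>k\<in>I. y k = x k} = (\<Inter>k\<in>I. {y \<in> full_shift A. y k \<in> {x k}})"
    by auto
  then show ?thesis
    using False closedin_full_shift_coord by (simp only:) (rule closedin_INT)
qed

lemma openin_full_shift_agree:
  assumes "finite I"
  shows "openin (full_shift_topology A) {y \<in> full_shift A. \<forall>k\<in>I. y k = x k}"
  using assms
proof (induction I)
  case empty
  then show ?case
    using openin_topspace[of "full_shift_topology A"] by (simp add: topspace_full_shift)
next
  case (insert i I)
  have "{y \<in> full_shift A. \<forall>k\<in>insert i I. y k = x k} =
      {y \<in> full_shift A. y i \<in> {x i}} \<inter> {y \<in> full_shift A. \<forall>k\<in>I. y k = x k}"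
    by auto
  then show ?case
    using openin_Int[OF openin_full_shift_coord insert.IH] by (simp only:)
qed

text \<open>The product of finite discrete spaces is compact by Tychonoff, and the identity from it
  to the metric space is continuous.\<close>

lemma compact_space_full_shift:
  assumes "finite A"
  shows "compact_space (full_shift_topology A)"
proof -
  let ?P = "product_topology (\<lambda>_::int. discrete_topology A) UNIV"
  have top: "topspace ?P = full_shift A"
    by (auto simp: full_shift_def PiE_def)
  have "continuous_map ?P (full_shift_topology A) id"
    unfolding full_shift_topology_def
  proof (subst Metric_space.continuous_map_to_metric[OF Metric_space_full_shift], intro ballI allI impI)
    fix x and e :: real assume x: "x \<in> topspace ?P" and "0 < e"
    then obtain m where m: "(1/2) ^ m < e"
      using real_arch_pow_inv[of e "1/2"] by auto
    \<comment> \<open>Fixing the coordinates from \<open>-m\<close> to \<open>m\<close> forces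
      distance below \<open>(1/2) ^ m\<close>, and finitely many such conditions are open in the
      product.\<close>
    define U where "U = topspace ?P \<inter> (\<Inter>k\<in>{- int m..int m}. {y \<in> topspace ?P. y k \<in> {x k}})"
    have "openin ?P {y \<in> topspace ?P. y k \<in> {x k}}" for k
      using x by (intro openin_continuous_map_preimage[OF continuous_map_product_projection])
        (auto simp: full_shift_def top)
    then have "openin ?P U"
      unfolding U_def by (intro openin_Int openin_topspace openin_INT2) simp_all
    moreover have "x \<in> U"
      using x by (auto simp: U_def)
    moreover have "id y \<in> Metric_space.mball (full_shift A) shift_dist (id x) e" if "y \<in> U" for y
    proof -
      have "shift_dist x y < (1/2) ^ m"
        unfolding shift_dist_less_iff
      proof (intro allI impI)
        fix n :: int assume "nat \<bar>n\<bar> \<le> m"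
        then have "n \<in> {- int m..int m}"
          by auto
        then have "y \<in> {y \<in> topspace ?P. y n \<in> {x n}}"
          using that unfolding U_def by (rule INT_D[OF IntD2, rotated])
        then show "x n = y n"
          by simp
      qed
      then show ?thesis
        using m that x unfolding Metric_space.in_mball[OF Metric_space_full_shift] U_def top id_apply
        by (meson IntD1 order_less_trans)
    qed
    ultimately show "\<exists>U. openin ?P U \<and> x \<in> U \<and>
        (\<forall>y\<in>U. id y \<in> Metric_space.mball (full_shift A) shift_dist (id x) e)"
      by blast
  qed
  moreover have "compact_space ?P"
    using assms by (simp add: compact_space_product_topology compact_space_discrete_topology)
  ultimately have "compactin (full_shift_topology A) (id ` topspace ?P)"
    using image_compactin compact_space_def by blast
  then show ?thesis
    unfolding top image_id compact_space_def topspace_full_shift by simp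
qed

text \<open>Leaves and cylinders both consist of the points that agree with a sequence on an index
  set. Any \<open>I\<close> gives a closed, hence compact set; finite \<open>J w\<close> give open
  sets. This form serves both directions of time.\<close>

lemma shift_space_finite_subcover:
  assumes X: "shift_space A X"
    and fin: "\<And>w. w \<in> E \<Longrightarrow> finite (J w)"
    and cov: "{y \<in> X. \<forall>k\<in>I. y k = x k} \<subseteq> (\<Union>w\<in>E. {y \<in> X. \<forall>k\<in>J w. y k = s w k})"
  shows "\<exists>F\<subseteq>E. finite F \<and>
    {y \<in> X. \<forall>k\<in>I. y k = x k} \<subseteq> (\<Union>w\<in>F. {y \<in> X. \<forall>k\<in>J w. y k = s w k})"
proof -
  have closed: "closedin (full_shift_topology A) X" and "finite A"
    using X by (auto simp: shift_space_def)
  have XA: "X \<subseteq> full_shift A"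
    using closedin_subset[OF closed] by (simp add: topspace_full_shift)
  \<comment> \<open>The cylinders are enlarged to the full shift, where they are open; within
    \<open>X\<close> they are in general only relatively open.\<close>
  define D where "D w = {y \<in> full_shift A. \<forall>k\<in>J w. y k = s w k}" for w
  have W: "{y \<in> X. \<forall>k\<in>I. y k = x k} = X \<inter> {y \<in> full_shift A. \<forall>k\<in>I. y k = x k}"
    using XA by auto
  have "closedin (full_shift_topology A) {y \<in> X. \<forall>k\<in>I. y k = x k}"
    unfolding W by (intro closedin_Int closed closedin_full_shift_agree)
  then have "compactin (full_shift_topology A) {y \<in> X. \<forall>k\<in>I. y k = x k}"
    using compact_space_full_shift[OF \<open>finite A\<close>] by (rule closedin_compact_space[rotated])
  moreover have "\<And>U. U \<in> D ` E \<Longrightarrow> openin (full_shift_topology A) U"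
    unfolding D_def using fin openin_full_shift_agree by auto
  moreover have "{y \<in> X. \<forall>k\<in>I. y k = x k} \<subseteq> \<Union> (D ` E)"
    using cov XA unfolding D_def by fastforce
  ultimately have "\<exists>\<F>. finite \<F> \<and> \<F> \<subseteq> D ` E \<and> {y \<in> X. \<forall>k\<in>I. y k = x k} \<subseteq> \<Union>\<F>"
    by (rule compactinD)
  then obtain \<F> where "finite \<F>" "\<F> \<subseteq> D ` E" and \<F>: "{y \<in> X. \<forall>k\<in>I. y k = x k} \<subseteq> \<Union>\<F>"
    by blast
  then obtain F where F: "F \<subseteq> E" "finite F" "\<F> = D ` F"
    using finite_subset_image[of \<F> D E] by blast
  have "{y \<in> X. \<forall>k\<in>I. y k = x k} \<subseteq> (\<Union>w\<in>F. {y \<in> X. \<forall>k\<in>J w. y k = s w k})"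
    using \<F> unfolding F(3) D_def by blast
  then show ?thesis
    using F by blast
qed

lemma potential_bounded_above:
  assumes X: "shift_space A X" and "potential A X \<phi>"
  obtains M where "\<And>y. y \<in> X \<Longrightarrow> \<phi> y \<le> M"
proof -
  have closed: "closedin (full_shift_topology A) X" and "finite A"
    using X by (auto simp: shift_space_def)
  then have "compactin (full_shift_topology A) X"
    using compact_space_full_shift closedin_compact_space by blast
  then have "compactin (subtopology (full_shift_topology A) X) X"
    by (simp add: compactin_subtopology)
  then have "compact (\<phi> ` X)"
    using assms(2) unfolding potential_def
    by (metis image_compactin compactin_euclidean_iff)
  then have "bdd_above (\<phi> ` X)"
    by (intro bounded_imp_bdd_above compact_imp_bounded)
  then show thesis
    using that by (auto simp: bdd_above_def)
qed

section \<open>Shifts, cylinders and weights\<close>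

lemma shift_funpow: "(shift ^^ k) x = (\<lambda>n. x (n + int k))"
  by (induction k) (auto simp: shift_def algebra_simps)

text \<open>Negative \<open>c\<close> relies on \<open>shift\<close> mapping \<open>X\<close> onto
  itself; injectivity of the shift on sequences identifies the preimage as the backward
  translate.\<close>

lemma shift_space_translate:
  assumes X: "shift_space A X" and y: "y \<in> X"
  shows "(\<lambda>n. y (n + c)) \<in> X"
proof -
  have img: "shift ` X = X"
    using X by (simp add: shift_space_def)
  have fwd: "(shift ^^ k) y \<in> X" for k
    by (induction k) (use y img in auto)
  have bwd: "(\<lambda>n. y (n - int k)) \<in> X" for k
  proof (induction k)
    case (Suc k)
    then obtain z where "z \<in> X" "(\<lambda>n. y (n - int k)) = shift z"
      using img by (metis imageE)
    moreover from this(2) have "z = (\<lambda>n. y (n - int (Suc k)))"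
      unfolding shift_def fun_eq_iff by (metis add.commute add_diff_cancel_left' diff_diff_eq of_nat_Suc diff_add_cancel)
    ultimately show ?case by simp
  qed (use y in simp)
  show ?thesis
    using fwd[of "nat c"] bwd[of "nat (- c)"] by (cases "c \<ge> 0") (auto simp: shift_funpow)
qed

text \<open>Translation moves the window ending at position \<open>0\<close> to the one starting
  there. This transfers facts about \<open>words\<close> and \<open>weight\<close>, both defined by
  forward cylinders, to stable leaves.\<close>

lemma cyl_minus_iff_cyl_plus:
  assumes X: "shift_space A X"
  shows "y \<in> cyl_minus X w \<longleftrightarrow> (\<lambda>n. y (n - int (length w) + 1)) \<in> cyl_plus X w"
proof -
  have "y \<in> X" if "(\<lambda>n. y (n - int (length w) + 1)) \<in> X"
    using shift_space_translate[OF X that, of "int (length w) - 1"] by simp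
  moreover have "(\<lambda>n. y (n - int (length w) + 1)) \<in> X" if "y \<in> X"
    using shift_space_translate[OF X that, of "1 - int (length w)"] by (simp add: algebra_simps)
  ultimately show ?thesis
    by (auto simp: cyl_minus_def cyl_plus_def)
qed

lemma wordsI_minus:
  assumes "shift_space A X" "y \<in> cyl_minus X w"
  shows "w \<in> words X (length w)"
  using assms cyl_minus_iff_cyl_plus by (fastforce simp: words_def)

lemma finite_words:
  assumes X: "shift_space A X"
  shows "finite (words X n)"
proof (rule finite_subset)
  have XA: "X \<subseteq> full_shift A" and "finite A"
    using X closedin_subset[of "full_shift_topology A" X]
    by (auto simp: shift_space_def topspace_full_shift)
  then show "finite {w. set w \<subseteq> A \<and> length w = n}"
    by (simp add: finite_lists_length_eq)
  have "set w \<subseteq> A" if "w \<in> words X n" for w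
  proof
    fix a assume "a \<in> set w"
    then obtain i where i: "i < length w" "a = w ! i"
      by (auto simp: in_set_conv_nth)
    obtain y where "y \<in> cyl_plus X w"
      using \<open>w \<in> words X n\<close> by (auto simp: words_def)
    then have "y \<in> full_shift A" "y (int i) = a"
      using XA i by (auto simp: cyl_plus_def)
    then show "a \<in> A"
      by (auto simp: full_shift_def)
  qed
  then show "words X n \<subseteq> {w. set w \<subseteq> A \<and> length w = n}"
    by (auto simp: words_def)
qed

lemma words_cover_plus: "y \<in> X \<Longrightarrow> \<exists>w\<in>words X n. y \<in> cyl_plus X w"
  by (intro bexI[of _ "map (\<lambda>i. y (int i)) [0..<n]"]) (auto simp: words_def cyl_plus_def)

lemma words_cover_minus:
  assumes X: "shift_space A X" and y: "y \<in> X"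
  shows "\<exists>w\<in>words X n. y \<in> cyl_minus X w"
proof -
  have "(\<lambda>i. y (i - int n + 1)) \<in> X"
    using shift_space_translate[OF X y, of "1 - int n"] by (simp add: algebra_simps)
  then obtain w where "w \<in> words X n" "(\<lambda>i. y (i - int n + 1)) \<in> cyl_plus X w"
    using words_cover_plus by metis
  then show ?thesis
    using cyl_minus_iff_cyl_plus[OF X, of y w] by (auto simp: words_def)
qed

section \<open>Concatenating and splitting words\<close>

lemma cyl_plus_append:
  assumes X: "shift_space A X" and y: "y \<in> cyl_plus X (w @ v)"
  shows "y \<in> cyl_plus X w" and "(shift ^^ length w) y \<in> cyl_plus X v"
proof -
  have yX: "y \<in> X" and y': "\<And>i. i < length w + length v \<Longrightarrow> y (int i) = (w @ v) ! i"
    using y by (auto simp: cyl_plus_def)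
  show "y \<in> cyl_plus X w"
    using yX y' by (auto simp: cyl_plus_def nth_append)
  have "y (int i + int (length w)) = v ! i" if "i < length v" for i
    using y'[of "i + length w"] that by (simp add: nth_append)
  then show "(shift ^^ length w) y \<in> cyl_plus X v"
    using shift_space_translate[OF X yX] by (simp add: cyl_plus_def shift_funpow)
qed

text \<open>The last letter sits at position \<open>0\<close>, so the suffix \<open>w\<close> stays
  in place, and the inverse shift moves \<open>v\<close> until it ends at \<open>0\<close>.\<close>

lemma cyl_minus_append:
  assumes X: "shift_space A X" and y: "y \<in> cyl_minus X (v @ w)"
  shows "y \<in> cyl_minus X w" and "(inv shift ^^ length w) y \<in> cyl_minus X v"
proof -
  have yX: "y \<in> X"
    and y': "\<And>i. i < length v + length w \<Longrightarrow> y (int i - int (length v + length w) + 1) = (v @ w) ! i"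
    using y by (auto simp: cyl_minus_def)
  have "y (int i - int (length w) + 1) = w ! i" if "i < length w" for i
    using y'[of "i + length v"] that by (simp add: nth_append)
  then show "y \<in> cyl_minus X w"
    using yX by (simp add: cyl_minus_def)
  have "y (int i - int (length v) + 1 - int (length w)) = v ! i" if "i < length v" for i
    using y'[of i] that by (simp add: nth_append algebra_simps)
  then show "(inv shift ^^ length w) y \<in> cyl_minus X v"
    using shift_space_translate[OF X yX, of "- int (length w)"]
    by (simp add: cyl_minus_def inv_shift_funpow)
qed

text \<open>Both words are read off the same point from position \<open>0\<close>, so
  \<open>w\<close> is a prefix of \<open>u\<close>; the shifted point witnesses that the rest is a
  word of the language.\<close>

lemma cyl_plus_split:
  assumes X: "shift_space A X" and "y \<in> cyl_plus X u" "y \<in> cyl_plus X w" "length w \<le> length u"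
  shows "\<exists>v\<in>words X (length u - length w). u = w @ v"
proof (intro bexI)
  have "take (length w) u = w"
    using assms by (intro nth_equalityI) (auto simp: cyl_plus_def)
  then show u: "u = w @ drop (length w) u"
    by (metis append_take_drop_id)
  show "drop (length w) u \<in> words X (length u - length w)"
    using cyl_plus_append(2)[OF X, of y w "drop (length w) u"] assms u
    by (auto simp: words_def)
qed

lemma cyl_minus_split:
  assumes X: "shift_space A X" and y: "y \<in> cyl_minus X u" "y \<in> cyl_minus X w"
    and le: "length w \<le> length u"
  shows "\<exists>v\<in>words X (length u - length w). u = v @ w"
proof (intro bexI)
  define d where "d = length u - length w"
  have "drop d u ! i = w ! i" if "i < length w" for i
  proof -
    have "w ! i = y (int i - int (length w) + 1)"
      using y(2) that by (simp add: cyl_minus_def)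
    \<comment> \<open>Both windows end at position \<open>0\<close>, so index \<open>i\<close> in
      \<open>w\<close> is index \<open>d + i\<close> in \<open>u\<close>.\<close>
    also have "\<dots> = y (int (d + i) - int (length u) + 1)"
      using le by (simp add: d_def of_nat_diff algebra_simps)
    also have "\<dots> = u ! (d + i)"
    proof -
      have "d + i < length u"
        using that le by (simp add: d_def)
      then show ?thesis
        using y(1) unfolding cyl_minus_def by blast
    qed
    finally show ?thesis
      using le by (simp add: d_def)
  qed
  then have "drop d u = w"
    using le by (intro nth_equalityI) (auto simp: d_def)
  then show u: "u = take (length u - length w) u @ w"
    unfolding d_def by (metis append_take_drop_id)
  have "(inv shift ^^ length w) y \<in> cyl_minus X (take (length u - length w) u)"
    using cyl_minus_append(2)[OF X] y(1) u by metis
  from wordsI_minus[OF X this]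
  show "take (length u - length w) u \<in> words X (length u - length w)"
    by simp
qed

section \<open>Birkhoff sums and submultiplicativity of weights\<close>

lemma birkhoff_add:
  "birkhoff \<phi> (m + n) y = birkhoff \<phi> m y + birkhoff \<phi> n ((shift ^^ m) y)"
  unfolding birkhoff_def
  by (induction n) (simp_all add: shift_funpow algebra_simps)

lemma back_birkhoff_add:
  "back_birkhoff \<phi> (m + n) y = back_birkhoff \<phi> m y + back_birkhoff \<phi> n ((inv shift ^^ m) y)"
  unfolding back_birkhoff_def
  by (induction n) (simp_all add: inv_shift_funpow algebra_simps)

text \<open>The backward orbit segment is the forward one started \<open>n - 1\<close> steps earlier
  and traversed in reverse.\<close>

lemma back_birkhoff_eq_birkhoff:
  "back_birkhoff \<phi> n y = birkhoff \<phi> n (\<lambda>i. y (i - int n + 1))"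
  unfolding back_birkhoff_def birkhoff_def
proof (rule sum.reindex_bij_witness[of _ "\<lambda>k. n - Suc k" "\<lambda>k. n - Suc k"])
  fix k assume "k \<in> {..<n}"
  then show "\<phi> ((shift ^^ (n - Suc k)) (\<lambda>i. y (i - int n + 1))) = \<phi> ((inv shift ^^ k) y)"
    unfolding shift_funpow inv_shift_funpow
    by (intro arg_cong[of _ _ \<phi>] ext arg_cong[of _ _ y]) (auto simp: of_nat_diff)
qed auto

text \<open>A real supremum bounds its members only if they are bounded above, which compactness of
  \<open>X\<close> provides.\<close>

lemma birkhoff_le_weight:
  assumes X: "shift_space A X" "potential A X \<phi>" and y: "y \<in> cyl_plus X w"
  shows "birkhoff \<phi> (length w) y \<le> weight X \<phi> w"
  unfolding weight_def
proof (rule cSUP_upper[OF y])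
  obtain M where M: "\<And>y. y \<in> X \<Longrightarrow> \<phi> y \<le> M"
    using potential_bounded_above[OF X] by blast
  have "birkhoff \<phi> (length w) z \<le> (\<Sum>k<length w. M)" if "z \<in> X" for z
    unfolding birkhoff_def shift_funpow using that
    by (intro sum_mono M shift_space_translate[OF X(1)])
  then show "bdd_above (birkhoff \<phi> (length w) ` cyl_plus X w)"
    by (intro bdd_aboveI2[where M = "\<Sum>k<length w. M"]) (simp add: cyl_plus_def)
qed

lemma back_birkhoff_le_weight:
  assumes "shift_space A X" "potential A X \<phi>" and "y \<in> cyl_minus X w"
  shows "back_birkhoff \<phi> (length w) y \<le> weight X \<phi> w"
  using assms birkhoff_le_weight by (simp add: back_birkhoff_eq_birkhoff cyl_minus_iff_cyl_plus)

text \<open>The Birkhoff sum splits after \<open>length w\<close> steps. The shifted point need not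
  lie on the leaf of \<open>x\<close>, so the second part is bounded by the global weight; this is
  how \<open>Q_sup\<close> enters.\<close>

lemma weight_plus_append:
  assumes X: "shift_space A X" "potential A X \<phi>"
  shows "weight_plus X \<phi> x (w @ v) \<le> weight_plus X \<phi> x w + ereal (weight X \<phi> v)"
  unfolding weight_plus_def[of X \<phi> x "w @ v"]
proof (rule SUP_least)
  fix y assume y: "y \<in> W_u X x \<inter> cyl_plus X (w @ v)"
  then have yw: "y \<in> W_u X x \<inter> cyl_plus X w"
    and yv: "(shift ^^ length w) y \<in> cyl_plus X v"
    using cyl_plus_append[OF X(1)] by blast+
  have "ereal (birkhoff \<phi> (length (w @ v)) y) =
      ereal (birkhoff \<phi> (length w) y) + ereal (birkhoff \<phi> (length v) ((shift ^^ length w) y))"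
    by (simp add: birkhoff_add)
  also have "\<dots> \<le> weight_plus X \<phi> x w + ereal (weight X \<phi> v)"
    unfolding weight_plus_def using birkhoff_le_weight[OF X yv]
    by (intro add_mono SUP_upper yw) simp
  finally show "ereal (birkhoff \<phi> (length (w @ v)) y) \<le> weight_plus X \<phi> x w + ereal (weight X \<phi> v)" .
qed

lemma weight_minus_append:
  assumes X: "shift_space A X" "potential A X \<phi>"
  shows "weight_minus X \<phi> x (v @ w) \<le> weight_minus X \<phi> x w + ereal (weight X \<phi> v)"
  unfolding weight_minus_def[of X \<phi> x "v @ w"]
proof (rule SUP_least)
  fix y assume y: "y \<in> W_s X x \<inter> cyl_minus X (v @ w)"
  then have yw: "y \<in> W_s X x \<inter> cyl_minus X w"
    and yv: "(inv shift ^^ length w) y \<in> cyl_minus X v"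
    using cyl_minus_append[OF X(1)] by blast+
  have "ereal (back_birkhoff \<phi> (length (v @ w)) y) =
      ereal (back_birkhoff \<phi> (length w) y) +
      ereal (back_birkhoff \<phi> (length v) ((inv shift ^^ length w) y))"
    by (simp add: back_birkhoff_add add.commute[of "length v"])
  also have "\<dots> \<le> weight_minus X \<phi> x w + ereal (weight X \<phi> v)"
    unfolding weight_minus_def using back_birkhoff_le_weight[OF X yv]
    by (intro add_mono SUP_upper yw) simp
  finally show "ereal (back_birkhoff \<phi> (length (v @ w)) y)
      \<le> weight_minus X \<phi> x w + ereal (weight X \<phi> v)" .
qed

section \<open>Comparison of leaf measures and partition sums\<close>

lemma exp_ereal_diff: "exp_ereal (s - ereal r) = exp_ereal s * ennreal (exp (- r))"
  by (cases s) (simp_all add: exp_ereal_def ennreal_mult[symmetric] exp_add[symmetric] ennreal_top_mult)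

text \<open>Exponentiation turns subadditive weights into the submultiplicative bound; the pressure
  factor splits because lengths add.\<close>

lemma exp_ereal_append:
  assumes "s \<le> t + ereal c"
  shows "exp_ereal (s - ereal (real (m + n) * P))
    \<le> exp_ereal (t - ereal (real m * P)) * ennreal (exp (c - real n * P))"
  using assms by (cases s; cases t)
    (auto simp: exp_ereal_def ennreal_mult[symmetric] exp_add[symmetric] ennreal_top_mult algebra_simps)

lemma sum_exp_ereal_words:
  "(\<Sum>w\<in>words X n. exp_ereal (f w - ereal (real (length w) * P))) =
    (\<Sum>w\<in>words X n. exp_ereal (f w)) * ennreal (exp (- (real n * P)))"
  unfolding sum_distrib_right by (intro sum.cong) (auto simp: exp_ereal_diff words_def)

text \<open>Moving the pressure factor into each term gives the shape \<open>limsup\<close> of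
  \<open>sum b (L n)\<close> used in \<open>leaf_measure_bounds\<close>.\<close>

lemma Q_sup_eq:
  "Q_sup X \<phi> = limsup (\<lambda>n. \<Sum>v\<in>words X n.
    ennreal (exp (weight X \<phi> v - real (length v) * pressure X \<phi>)))"
proof -
  have "ennreal (partition_sum X \<phi> n * exp (- (real n * pressure X \<phi>))) =
      (\<Sum>v\<in>words X n. ennreal (exp (weight X \<phi> v - real (length v) * pressure X \<phi>)))" for n
  proof -
    have "partition_sum X \<phi> n * exp (- (real n * pressure X \<phi>)) =
        (\<Sum>v\<in>words X n. exp (weight X \<phi> v - real (length v) * pressure X \<phi>))"
      unfolding partition_sum_def sum_distrib_right exp_add[symmetric]
      by (intro sum.cong) (auto simp: words_def)
    then show ?thesis
      by (simp add: sum_ennreal)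
  qed
  then show ?thesis
    by (simp add: Q_sup_def)
qed

lemma m_u_bounds:
  assumes X: "shift_space A X" "potential A X \<phi>"
  shows "Q_plus_sup X \<phi> x / Q_sup X \<phi> \<le> m_u X \<phi> x (W_u X x)"
    and "m_u X \<phi> x (W_u X x) \<le> Q_plus_inf X \<phi> x"
proof -
  let ?a = "\<lambda>w. exp_ereal (weight_plus X \<phi> x w - ereal (real (length w) * pressure X \<phi>))"
  let ?b = "\<lambda>v. ennreal (exp (weight X \<phi> v - real (length v) * pressure X \<phi>))"
  have compact: "\<exists>F\<subseteq>E. finite F \<and> W_u X x \<subseteq> (\<Union>w\<in>F. cyl_plus X w)"
    if "W_u X x \<subseteq> (\<Union>w\<in>E. cyl_plus X w)" for E
  proof -
    have W: "W_u X x = {y \<in> X. \<forall>k\<in>{..0}. y k = x k}"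
      by (auto simp: W_u_def)
    have C: "cyl_plus X w = {y \<in> X. \<forall>k\<in>int ` {..<length w}. y k = w ! nat k}" for w
      by (auto simp: cyl_plus_def)
    show ?thesis
      using that unfolding W C by (intro shift_space_finite_subcover[OF X(1)]) auto
  qed
  have cover: "W_u X x \<subseteq> (\<Union>w\<in>words X n. cyl_plus X w)" for n
    using words_cover_plus by (fastforce simp: W_u_def)
  have null: "?a w = 0" if "W_u X x \<inter> cyl_plus X w = {}" for w
    \<comment> \<open>The supremum over the empty set is \<open>bot\<close>, that is
      \<open>-\<infinity>\<close>, which \<open>exp_ereal\<close> sends to \<open>0\<close>.\<close>
    using that by (simp add: weight_plus_def exp_ereal_def bot_ereal_def)
  have split: "\<exists>v\<in>words X (length u - length w). u = w @ v"
    if "y \<in> W_u X x" "y \<in> cyl_plus X u" "y \<in> cyl_plus X w" "u \<in> words X (length u)"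
      "length w \<le> length u" for y u w
    using cyl_plus_split[OF X(1) that(2,3,5)] .
  have submult: "?a (w @ v) \<le> ?a w * ?b v" for w v
    using exp_ereal_append[OF weight_plus_append[OF X]] by simp
  have len: "length w = n" if "w \<in> words X n" for n w
    using that by (simp add: words_def)
  note bounds = leaf_measure_bounds[of "words X" "W_u X x" "cyl_plus X" ?a "(@)" ?b,
      OF finite_words[OF X(1)] len cover compact null split submult]
  show "Q_plus_sup X \<phi> x / Q_sup X \<phi> \<le> m_u X \<phi> x (W_u X x)"
    using bounds(1)
    by (simp add: Q_plus_sup_def Q_sup_eq m_u_def covers_plus_def words_ge_def
        partition_sum_plus_def sum_exp_ereal_words)
  show "m_u X \<phi> x (W_u X x) \<le> Q_plus_inf X \<phi> x"
    using bounds(2)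
    by (simp add: Q_plus_inf_def m_u_def covers_plus_def words_ge_def
        partition_sum_plus_def sum_exp_ereal_words)
qed

lemma m_s_bounds:
  assumes X: "shift_space A X" "potential A X \<phi>"
  shows "Q_minus_sup X \<phi> x / Q_sup X \<phi> \<le> m_s X \<phi> x (W_s X x)"
    and "m_s X \<phi> x (W_s X x) \<le> Q_minus_inf X \<phi> x"
proof -
  let ?a = "\<lambda>w. exp_ereal (weight_minus X \<phi> x w - ereal (real (length w) * pressure X \<phi>))"
  let ?b = "\<lambda>v. ennreal (exp (weight X \<phi> v - real (length v) * pressure X \<phi>))"
  have compact: "\<exists>F\<subseteq>E. finite F \<and> W_s X x \<subseteq> (\<Union>w\<in>F. cyl_minus X w)"
    if "W_s X x \<subseteq> (\<Union>w\<in>E. cyl_minus X w)" for E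
  proof -
    have W: "W_s X x = {y \<in> X. \<forall>k\<in>{0..}. y k = x k}"
      by (auto simp: W_s_def)
    \<comment> \<open>\<open>nat (k + int (length w) - 1)\<close> recovers the index of the letter
      at position \<open>k\<close>.\<close>
    have C: "cyl_minus X w = {y \<in> X. \<forall>k\<in>(\<lambda>i. int i - int (length w) + 1) ` {..<length w}.
        y k = w ! nat (k + int (length w) - 1)}" for w
      by (auto simp: cyl_minus_def)
    show ?thesis
      using that unfolding W C by (intro shift_space_finite_subcover[OF X(1)]) auto
  qed
  have cover: "W_s X x \<subseteq> (\<Union>w\<in>words X n. cyl_minus X w)" for n
    using words_cover_minus[OF X(1)] by (fastforce simp: W_s_def)
  have null: "?a w = 0" if "W_s X x \<inter> cyl_minus X w = {}" for w
    using that by (simp add: weight_minus_def exp_ereal_def bot_ereal_def)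
  have split: "\<exists>v\<in>words X (length u - length w). u = v @ w"
    if "y \<in> W_s X x" "y \<in> cyl_minus X u" "y \<in> cyl_minus X w" "u \<in> words X (length u)"
      "length w \<le> length u" for y u w
    using cyl_minus_split[OF X(1) that(2,3,5)] .
  have submult: "?a (v @ w) \<le> ?a w * ?b v" for w v
    \<comment> \<open>The lengths are given explicitly because \<open>length (v @ w)\<close> unfolds
      in the opposite order.\<close>
    using exp_ereal_append[OF weight_minus_append[OF X], of _ _ _ "length w" "length v"]
    by (simp add: add.commute)
  have len: "length w = n" if "w \<in> words X n" for n w
    using that by (simp add: words_def)
  note bounds = leaf_measure_bounds[of "words X" "W_s X x" "cyl_minus X" ?a "\<lambda>w v. v @ w" ?b,
      OF finite_words[OF X(1)] len cover compact null split submult]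
  show "Q_minus_sup X \<phi> x / Q_sup X \<phi> \<le> m_s X \<phi> x (W_s X x)"
    using bounds(1)
    by (simp add: Q_minus_sup_def Q_sup_eq m_s_def covers_minus_def words_ge_def
        partition_sum_minus_def sum_exp_ereal_words)
  show "m_s X \<phi> x (W_s X x) \<le> Q_minus_inf X \<phi> x"
    using bounds(2)
    by (simp add: Q_minus_inf_def m_s_def covers_minus_def words_ge_def
        partition_sum_minus_def sum_exp_ereal_words)
qed

theorem theorem1p5:
  fixes A :: "'a set" and X :: "(int \<Rightarrow> 'a) set" and \<phi> :: "(int \<Rightarrow> 'a) \<Rightarrow> real"
  assumes "shift_space A X"
    and "potential A X \<phi>"
  shows "\<forall>x\<in>X.
    Q_plus_sup X \<phi> x / Q_sup X \<phi> \<le> m_u X \<phi> x (W_u X x) \<and>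
    m_u X \<phi> x (W_u X x) \<le> Q_plus_inf X \<phi> x \<and>
    Q_minus_sup X \<phi> x / Q_sup X \<phi> \<le> m_s X \<phi> x (W_s X x) \<and>
    m_s X \<phi> x (W_s X x) \<le> Q_minus_inf X \<phi> x"
  using m_u_bounds[OF assms] m_s_bounds[OF assms] by blast

end
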